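(* Let $(X,\mathcal A)$ be a measurable space, $\mu$ a monotone measure on $\mathcal A$, and $A\in\mathcal A$. Let $\circ\colon[0,\infty]\times[0,\infty]\to[0,\infty]$ be a nondecreasing map such that $x\mapsto x\circ y$ is right-continuous for every fixed $y$ and $a\circ 0=0$ for all $a$. Let $H\colon[0,\infty]\to[0,\infty]$ be Borel measurable and $f\colon X\to[0,\infty]$ be such that $f$ and $H(f)=H\circ f$ are $\mathcal A$-measurable, and suppose that $p:=\mathrm{Su}(f;A,\mu)<\infty$. (i) The following inequality holds: $$\int_{\circ,A}H(f)\,\mathrm d\mu\ \le\ \Big[\big(H(p^+)\vee\sup H([0,p])\big)\circ\mu(A)\Big]\vee\Big[\sup H\circ p\Big].$$ Equality holds here for $f=y_0\mathbf 1_A$ if $H$ is right-continuous at $p$, $H(p)=\sup H([0,p])$, and $y_0$ is such that $H(y_0)=\sup H$. (ii) If $\mu$ is weakly superadditive on $A$, then $$\int_{\circ,A}H(f)\,\mathrm d\mu\ \le\ \Big[\big(H(p^-)\vee\sup H([p,\infty])\big)\circ\mu(A)\Big]\vee\Big[\sup H\circ(\mu(A)-p)\Big].$$ Equality holds here for $f=\mu(A)\mathbf 1_A$ if (for the corresponding $p$) $H$ is left-continuous at $p$ and $H(p)=\sup H([p,\infty])$.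
   Context: A monotone measure on $\mathcal A$ is a set function $\mu\colon\mathcal A\to[0,\infty]$ with $\mu(\emptyset)=0$ and $\mu(B)\le\mu(C)$ whenever $B\subset C$. A binary map $\circ$ is nondecreasing if $a\circ b\le c\circ d$ whenever $a\le c$ and $b\le d$. Notation: $a\wedge b=\min(a,b)$, $a\vee b=\max(a,b)$; $\mathbf 1_A$ is the indicator function of $A$. Generalized Sugeno integral: for measurable $g\colon X\to[0,\infty]$, $$\int_{\circ,A}g\,\mathrm d\mu=\sup_{t\in[0,\infty]}\big\{t\circ\mu(A\cap\{g\ge t\})\big\},\qquad \{g\ge t\}=\{x\in X: g(x)\ge t\}.$$ Sugeno integral: $\mathrm{Su}(g;A,\mu)=\sup_{t\ge0}\{t\wedge\mu(A\cap\{g\ge t\})\}$. $\mu$ is weakly superadditive on $A$ if $\mu(A)\ge\mu(A\cap B)+\mu(A\cap B^c)$ for all $B\in\mathcal A$, where $B^c=X\setminus B$. $\sup H(D)=\sup_{y\in D}H(y)$ for $D\subset[0,\infty]$, and $\sup H=\sup H([0,\infty])$. The expression $\sup H\circ b$ means $(\sup H)\circ b$. Upper one-sided limits: $H(p^-)=\lim_{\varepsilon\to0^+}\sup H((p-\varepsilon,p))$ for $p>0$, with the convention $H(0^-)=0$, and $H(p^+)=\lim_{\varepsilon\to0^+}\sup H((p,p+\varepsilon))$. *)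

theory Defs
  imports "HOL-Analysis.Analysis"
begin

text \<open>A measure object \<open>M\<close> serves only as the measurable space \<open>(space M, sets M)\<close>; its own measure
  is never used. Monotone measures are separate set functions \<open>\<mu>\<close>, relevant only on \<open>sets M\<close>.\<close>

definition monotone_measure :: "'a measure \<Rightarrow> ('a set \<Rightarrow> ennreal) \<Rightarrow> bool" where
  "monotone_measure M \<mu> \<longleftrightarrow>
     \<mu> {} = 0 \<and> (\<forall>B\<in>sets M. \<forall>C\<in>sets M. B \<subseteq> C \<longrightarrow> \<mu> B \<le> \<mu> C)"

definition nondecreasing_map :: "(ennreal \<Rightarrow> ennreal \<Rightarrow> ennreal) \<Rightarrow> bool" where
  "nondecreasing_map circ \<longleftrightarrow> (\<forall>a b c d. a \<le> c \<longrightarrow> b \<le> d \<longrightarrow> circ a b \<le> circ c d)"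

definition gen_Sugeno_integral ::
  "(ennreal \<Rightarrow> ennreal \<Rightarrow> ennreal) \<Rightarrow> 'a measure \<Rightarrow> ('a set \<Rightarrow> ennreal) \<Rightarrow> 'a set \<Rightarrow> ('a \<Rightarrow> ennreal) \<Rightarrow> ennreal"
where
  "gen_Sugeno_integral circ M \<mu> A g = (SUP t. circ t (\<mu> (A \<inter> {x \<in> space M. g x \<ge> t})))"

definition Sugeno_integral ::
  "'a measure \<Rightarrow> ('a set \<Rightarrow> ennreal) \<Rightarrow> 'a set \<Rightarrow> ('a \<Rightarrow> ennreal) \<Rightarrow> ennreal"
where
  "Sugeno_integral M \<mu> A g = (SUP t. min t (\<mu> (A \<inter> {x \<in> space M. g x \<ge> t})))"

definition weakly_superadditive_on :: "'a measure \<Rightarrow> ('a set \<Rightarrow> ennreal) \<Rightarrow> 'a set \<Rightarrow> bool" where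
  "weakly_superadditive_on M \<mu> A \<longleftrightarrow>
     (\<forall>B\<in>sets M. \<mu> A \<ge> \<mu> (A \<inter> B) + \<mu> (A \<inter> (space M - B)))"

text \<open>Upper one-sided limits \<open>H(p\<^sup>-)\<close> and \<open>H(p\<^sup>+)\<close>, meant for finite \<open>p\<close>. The subtraction
  \<open>p - \<epsilon>\<close> is truncated at 0, which is harmless: for \<open>p > 0\<close> only \<open>\<epsilon> < p\<close> matters in the limit.\<close>

definition upper_left_limit :: "(ennreal \<Rightarrow> ennreal) \<Rightarrow> ennreal \<Rightarrow> ennreal" where
  "upper_left_limit H p =
     (if p = 0 then 0 else Lim (at_right 0) (\<lambda>\<epsilon>. SUP y\<in>{p - \<epsilon> <..< p}. H y))"

definition upper_right_limit :: "(ennreal \<Rightarrow> ennreal) \<Rightarrow> ennreal \<Rightarrow> ennreal" where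
  "upper_right_limit H p = Lim (at_right 0) (\<lambda>\<epsilon>. SUP y\<in>{p <..< p + \<epsilon>}. H y)"

end

theory Submission imports Defs begin

text \<open>Every level \<open>t > p\<close> satisfies \<open>\<mu>(A \<inter> {f \<ge> t}) \<le> p\<close> and every level \<open>t < p\<close> satisfies
  \<open>\<mu>(A \<inter> {f \<ge> t}) \<ge> p\<close>. If \<open>t\<close> exceeds \<open>H(p\<^sup>+) \<or> sup H([0,p])\<close>, then \<open>H < t\<close> on some \<open>[0, p + \<epsilon>)\<close>,
  so \<open>{H(f) \<ge> t}\<close> lies in \<open>{f \<ge> p + \<epsilon>}\<close> and has measure at most \<open>p\<close>. In (ii) it lies instead in the
  complement of some \<open>{f \<ge> s}\<close> with \<open>s < p\<close>, so weak superadditivity bounds its measure by \<open>\<mu>(A) - p\<close>.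
  Smaller \<open>t\<close> are bounded by monotonicity, and the equality cases use the level
  \<open>t = H(y\<^sub>0)\<close>, with \<open>y\<^sub>0 = \<mu>(A) = p\<close> in (ii).\<close>

section \<open>One-sided upper limits as infima\<close>

lemma at_right_neq_bot:
  fixes x b :: "'a::{linorder_topology, dense_order}"
  assumes "x < b"
  shows "at_right x \<noteq> bot"
  unfolding trivial_limit_def eventually_at_right[OF assms] using dense by blast

text \<open>A bound below the infimum lies below every \<open>F x\<close> with \<open>a < x\<close>;
  a bound above it exceeds some \<open>F e\<close>, and monotonicity carries this to all
  \<open>x < e\<close>.\<close>

lemma mono_tendsto_at_right:
  fixes F :: "'a::{linorder_topology, dense_order} \<Rightarrow> 'b::{complete_linorder, linorder_topology}"
  assumes "mono F" and "a < b"
  shows "(F \<longlongrightarrow> (INF x\<in>{a<..}. F x)) (at_right a)"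
proof (rule order_tendstoI)
  fix c assume "c < (INF x\<in>{a<..}. F x)"
  then have "c < F x" if "a < x" for x
    using that by (meson INF_lower greaterThan_iff less_le_trans)
  then show "\<forall>\<^sub>F x in at_right a. c < F x"
    using \<open>a < b\<close> by (auto simp: eventually_at_right[OF \<open>a < b\<close>])
next
  fix c assume "(INF x\<in>{a<..}. F x) < c"
  then obtain e where e: "a < e" "F e < c"
    by (auto simp: INF_less_iff)
  have "F x < c" if "x < e" for x
    using monoD[OF \<open>mono F\<close> less_imp_le[OF that]] e(2) by (rule le_less_trans)
  then show "\<forall>\<^sub>F x in at_right a. F x < c"
    using e(1) by (auto simp: eventually_at_right[OF \<open>a < b\<close>])
qed

text \<open>Density makes the filter nontrivial, so the limit is unique and \<open>Lim\<close>
  really returns it.\<close>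

lemma Lim_at_right_mono:
  fixes F :: "'a::{linorder_topology, dense_order} \<Rightarrow> 'b::{complete_linorder, linorder_topology}"
  assumes "mono F" and "a < b"
  shows "Lim (at_right a) F = (INF x\<in>{a<..}. F x)"
  using assms by (intro tendsto_Lim at_right_neq_bot mono_tendsto_at_right)

text \<open>The interval grows with \<open>e\<close>, so its supremum is monotone in
  \<open>e\<close>. In this form a strict upper bound on the limit yields a concrete
  \<open>e\<close>.\<close>

lemma upper_right_limit_eq_INF:
  "upper_right_limit H p = (INF e\<in>{0<..}. SUP y\<in>{p<..<p + e}. H y)"
  unfolding upper_right_limit_def
proof (rule Lim_at_right_mono[OF monoI zero_less_one])
  fix e e' :: ennreal assume "e \<le> e'"
  then have "p + e \<le> p + e'" by (simp add: add_left_mono)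
  then show "(SUP y\<in>{p<..<p + e}. H y) \<le> (SUP y\<in>{p<..<p + e'}. H y)"
    by (intro SUP_subset_mono) (auto intro: less_le_trans[OF _ \<open>p + e \<le> p + e'\<close>])
qed

lemma upper_left_limit_eq_INF:
  assumes "p \<noteq> 0"
  shows "upper_left_limit H p = (INF e\<in>{0<..}. SUP y\<in>{p - e<..<p}. H y)"
proof -
  have "Lim (at_right 0) (\<lambda>e. SUP y\<in>{p - e<..<p}. H y) = (INF e\<in>{0<..}. SUP y\<in>{p - e<..<p}. H y)"
  proof (rule Lim_at_right_mono[OF monoI zero_less_one])
    fix e e' :: ennreal assume "e \<le> e'"
    then have "p - e' \<le> p - e" by (simp add: ennreal_minus_mono)
    then show "(SUP y\<in>{p - e<..<p}. H y) \<le> (SUP y\<in>{p - e'<..<p}. H y)"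
      by (intro SUP_subset_mono) (auto intro: le_less_trans)
  qed
  with assms show ?thesis by (simp add: upper_left_limit_def)
qed

lemma upper_right_limit_le_SUP: "upper_right_limit H p \<le> (SUP y. H y)"
  unfolding upper_right_limit_eq_INF by (rule INF_lower2[of 1]) (auto intro: SUP_subset_mono)

lemma upper_right_limit_lessD:
  assumes "upper_right_limit H p < t" and "p < \<infinity>"
  obtains s where "p < s" "\<And>y. p < y \<Longrightarrow> y < s \<Longrightarrow> H y < t"
proof -
  obtain e where e: "0 < e" "(SUP y\<in>{p<..<p + e}. H y) < t"
    using assms(1) by (auto simp: upper_right_limit_eq_INF INF_less_iff)
  \<comment> \<open>Finiteness of \<open>p\<close> enters here: adding \<open>e\<close> to
    \<infinity> would not move it.\<close>
  have "p < p + e"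
    using e(1) assms ennreal_add_left_cancel_less[of p 0 e] by simp
  moreover have "H y < t" if "p < y" "y < p + e" for y
    using SUP_upper[of y "{p<..<p + e}" H] e(2) that by (simp add: le_less_trans)
  ultimately show thesis using that by blast
qed

lemma upper_left_limit_lessD:
  assumes "upper_left_limit H p < t" and "0 < p" "p < \<infinity>"
  obtains s where "s < p" "\<And>y. s < y \<Longrightarrow> y < p \<Longrightarrow> H y < t"
proof -
  obtain e where e: "0 < e" "(SUP y\<in>{p - e<..<p}. H y) < t"
    using assms by (auto simp: upper_left_limit_eq_INF INF_less_iff)
  have "p - e < p"
    using e(1) assms by (simp add: ennreal_between)
  moreover have "H y < t" if "p - e < y" "y < p" for y
    using SUP_upper[of y "{p - e<..<p}" H] e(2) that by (simp add: le_less_trans)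
  ultimately show thesis using that by blast
qed

lemma upper_left_limit_le:
  assumes "continuous (at_left p) H" and "p < \<infinity>"
  shows "upper_left_limit H p \<le> H p"
proof (cases "p = 0")
  case True
  then show ?thesis by (simp add: upper_left_limit_def)
next
  case False
  then have "0 < p" by (simp add: zero_less_iff_neq_zero)
  show ?thesis
  proof (rule dense_ge)
    fix c assume "H p < c"
    with assms(1) have "\<forall>\<^sub>F y in at_left p. H y < c"
      by (auto simp: continuous_within intro: order_tendstoD)
    then obtain b where b: "b < p" "\<And>y. b < y \<Longrightarrow> y < p \<Longrightarrow> H y < c"
      by (auto simp: eventually_at_left[OF \<open>0 < p\<close>])
    \<comment> \<open>The witness in the infimum is \<open>e = p - b\<close>; since
      \<open>b < p < \<infinity>\<close>, truncated subtraction recovers the interval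
      \<open>(b, p)\<close>.\<close>
    have "p - (p - b) = b"
      using b(1) assms(2) by (simp add: diff_diff_ennreal)
    then have "(SUP y\<in>{p - (p - b)<..<p}. H y) \<le> c"
      by (metis (no_types, lifting) SUP_least b(2) greaterThanLessThan_iff less_imp_le)
    moreover have "0 < p - b"
      using b(1) by (simp add: diff_gr0_ennreal)
    ultimately show "upper_left_limit H p \<le> c"
      unfolding upper_left_limit_eq_INF[OF False] by (auto intro: INF_lower2)
  qed
qed

section \<open>Level sets and the two integrals\<close>

lemma Sugeno_level_le:
  assumes "Sugeno_integral M \<mu> A f < t"
  shows "\<mu> (A \<inter> {x \<in> space M. t \<le> f x}) \<le> Sugeno_integral M \<mu> A f"
proof -
  have "min t (\<mu> (A \<inter> {x \<in> space M. t \<le> f x})) \<le> Sugeno_integral M \<mu> A f"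
    unfolding Sugeno_integral_def by (rule SUP_upper) simp
  \<comment> \<open>The minimum is below \<open>t\<close>, so it must be the measure.\<close>
  with assms show ?thesis by (auto simp: min_def split: if_splits)
qed

context
  fixes M :: "'a measure" and \<mu> :: "'a set \<Rightarrow> ennreal" and A :: "'a set"
  assumes mono_measure: "monotone_measure M \<mu>" and A_sets: "A \<in> sets M"
begin

lemma monotone_measure_mono: "B \<in> sets M \<Longrightarrow> C \<in> sets M \<Longrightarrow> B \<subseteq> C \<Longrightarrow> \<mu> B \<le> \<mu> C"
  using mono_measure by (simp add: monotone_measure_def)

lemma level_sets:
  fixes f :: "'a \<Rightarrow> ennreal"
  assumes [measurable]: "f \<in> borel_measurable M"
  shows "A \<inter> {x \<in> space M. t \<le> f x} \<in> sets M"
  by (rule sets.Int[OF A_sets]) measurable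

lemma level_le:
  fixes f :: "'a \<Rightarrow> ennreal"
  assumes "f \<in> borel_measurable M"
  shows "\<mu> (A \<inter> {x \<in> space M. t \<le> f x}) \<le> \<mu> A"
  by (intro monotone_measure_mono level_sets[OF assms] A_sets) auto

lemma Sugeno_integral_le:
  assumes "f \<in> borel_measurable M"
  shows "Sugeno_integral M \<mu> A f \<le> \<mu> A"
  unfolding Sugeno_integral_def by (intro SUP_least min.coboundedI2 level_le assms)

text \<open>Any \<open>u\<close> strictly between \<open>t\<close> and the integral is exceeded at
  some level \<open>s\<close>; then \<open>t < u < s\<close>, and the level set at \<open>t\<close>
  contains the one at \<open>s\<close>. Density lets \<open>u\<close> tend to the integral.\<close>

lemma Sugeno_le_level:
  assumes f: "f \<in> borel_measurable M" and "t < Sugeno_integral M \<mu> A f"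
  shows "Sugeno_integral M \<mu> A f \<le> \<mu> (A \<inter> {x \<in> space M. t \<le> f x})"
proof (rule dense_le_bounded[OF assms(2)])
  fix u assume u: "t < u" "u < Sugeno_integral M \<mu> A f"
  then obtain s where s: "u < s" "u < \<mu> (A \<inter> {x \<in> space M. s \<le> f x})"
    by (auto simp: Sugeno_integral_def less_SUP_iff)
  have "\<mu> (A \<inter> {x \<in> space M. s \<le> f x}) \<le> \<mu> (A \<inter> {x \<in> space M. t \<le> f x})"
    using u(1) s(1) by (intro monotone_measure_mono level_sets f) auto
  with s(2) show "u \<le> \<mu> (A \<inter> {x \<in> space M. t \<le> f x})" by simp
qed

text \<open>The level set at \<open>c\<close> is all of \<open>A\<close>. This supplies the lower
  bound in both equality cases.\<close>

lemma gen_Sugeno_integral_ge: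
  assumes "\<And>x. x \<in> A \<Longrightarrow> c \<le> g x"
  shows "circ c (\<mu> A) \<le> gen_Sugeno_integral circ M \<mu> A g"
proof -
  have level: "A \<inter> {x \<in> space M. c \<le> g x} = A"
    using assms sets.sets_into_space[OF A_sets] by auto
  have "circ c (\<mu> (A \<inter> {x \<in> space M. c \<le> g x})) \<le> gen_Sugeno_integral circ M \<mu> A g"
    unfolding gen_Sugeno_integral_def by (rule SUP_upper) simp
  then show ?thesis
    unfolding level .
qed

text \<open>Levels \<open>t > sup H\<close> contribute nothing because \<open>circ t 0 = 0\<close>.\<close>

lemma gen_Sugeno_integral_le:
  assumes circ: "nondecreasing_map circ" "\<And>a. circ a 0 = 0"
    and g: "(\<lambda>x. H (f x)) \<in> borel_measurable M"
    and level: "\<And>t. K < t \<Longrightarrow> \<mu> (A \<inter> {x \<in> space M. t \<le> H (f x)}) \<le> r"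
  shows "gen_Sugeno_integral circ M \<mu> A (\<lambda>x. H (f x)) \<le> max (circ K (\<mu> A)) (circ (SUP y. H y) r)"
  unfolding gen_Sugeno_integral_def
proof (rule SUP_least)
  fix t
  have mono: "circ a b \<le> circ c d" if "a \<le> c" "b \<le> d" for a b c d
    using circ(1) that by (simp add: nondecreasing_map_def)
  \<comment> \<open>Up to \<open>K\<close> the crude bound \<open>\<mu> A\<close> suffices; between
    \<open>K\<close> and the supremum of \<open>H\<close> the assumed bound \<open>r\<close> takes
    over.\<close>
  consider "t \<le> K" | "K < t" "t \<le> (SUP y. H y)" | "(SUP y. H y) < t" by force
  then show "circ t (\<mu> (A \<inter> {x \<in> space M. t \<le> H (f x)})) \<le> max (circ K (\<mu> A)) (circ (SUP y. H y) r)"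
  proof cases
    case 1
    then show ?thesis by (intro max.coboundedI1 mono level_le[OF g])
  next
    case 2
    then show ?thesis by (intro max.coboundedI2 mono level)
  next
    case 3
    then have empty: "{x \<in> space M. t \<le> H (f x)} = {}"
      by (auto simp: not_le intro: le_less_trans[OF SUP_upper])
    show ?thesis
      using mono_measure circ(2) unfolding empty by (simp add: monotone_measure_def)
  qed
qed

end

section \<open>The two inequalities and their equality cases\<close>

theorem theorem2p2:
  fixes M :: "'a measure" and \<mu> :: "'a set \<Rightarrow> ennreal" and A :: "'a set"
    and circ :: "ennreal \<Rightarrow> ennreal \<Rightarrow> ennreal"
    and H :: "ennreal \<Rightarrow> ennreal" and f :: "'a \<Rightarrow> ennreal" and p :: ennreal
  assumes "monotone_measure M \<mu>" and "A \<in> sets M"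
    and "nondecreasing_map circ"
    and "\<And>x y. continuous (at_right x) (\<lambda>z. circ z y)"
    and "\<And>a. circ a 0 = 0"
    and "H \<in> borel_measurable borel"
    and "f \<in> borel_measurable M"
    and "(\<lambda>x. H (f x)) \<in> borel_measurable M"
    and "p = Sugeno_integral M \<mu> A f" and "p < \<infinity>"
  shows "(gen_Sugeno_integral circ M \<mu> A (\<lambda>x. H (f x))
            \<le> max (circ (max (upper_right_limit H p) (SUP y\<in>{0..p}. H y)) (\<mu> A))
                   (circ (SUP y. H y) p)
          \<and> (\<forall>y0. (\<forall>x\<in>space M. f x = y0 * indicator A x) \<longrightarrow>
                 continuous (at_right p) H \<longrightarrow>
                 H p = (SUP y\<in>{0..p}. H y) \<longrightarrow>
                 H y0 = (SUP y. H y) \<longrightarrow>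
                 gen_Sugeno_integral circ M \<mu> A (\<lambda>x. H (f x))
                   = max (circ (max (upper_right_limit H p) (SUP y\<in>{0..p}. H y)) (\<mu> A))
                         (circ (SUP y. H y) p)))
       \<and> (weakly_superadditive_on M \<mu> A \<longrightarrow>
            gen_Sugeno_integral circ M \<mu> A (\<lambda>x. H (f x))
              \<le> max (circ (max (upper_left_limit H p) (SUP y\<in>{p..}. H y)) (\<mu> A))
                     (circ (SUP y. H y) (\<mu> A - p))
          \<and> ((\<forall>x\<in>space M. f x = \<mu> A * indicator A x) \<longrightarrow>
                 continuous (at_left p) H \<longrightarrow>
                 H p = (SUP y\<in>{p..}. H y) \<longrightarrow>
                 gen_Sugeno_integral circ M \<mu> A (\<lambda>x. H (f x))
                   = max (circ (max (upper_left_limit H p) (SUP y\<in>{p..}. H y)) (\<mu> A))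
                         (circ (SUP y. H y) (\<mu> A - p))))"
proof -
  note [measurable] = assms(2,7,8)
  let ?S = "SUP y. H y"
  let ?I = "gen_Sugeno_integral circ M \<mu> A (\<lambda>x. H (f x))"
  let ?KR = "max (upper_right_limit H p) (SUP y\<in>{0..p}. H y)"
  let ?KL = "max (upper_left_limit H p) (SUP y\<in>{p..}. H y)"
  have mono: "circ a b \<le> circ c d" if "a \<le> c" "b \<le> d" for a b c d
    using assms(3) that by (simp add: nondecreasing_map_def)
  have p_le: "p \<le> \<mu> A"
    using Sugeno_integral_le[OF assms(1,2,7)] assms(9) by simp
  have AM: "A \<subseteq> space M" using assms(2) by (rule sets.sets_into_space)

  have I1: "?I \<le> max (circ ?KR (\<mu> A)) (circ ?S p)"
  proof (rule gen_Sugeno_integral_le[where H = H and f = f, OF assms(1,2,3,5,8)])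
    fix t assume t: "?KR < t"
    then obtain s where s: "p < s" "\<And>y. p < y \<Longrightarrow> y < s \<Longrightarrow> H y < t"
      using upper_right_limit_lessD[of H p t] assms(10) by auto
    \<comment> \<open>Below \<open>s\<close>, \<open>H\<close> stays under \<open>t\<close>: on
      \<open>[0, p]\<close> by the supremum, on \<open>(p, s)\<close> by the right limit.\<close>
    have "s \<le> y" if "t \<le> H y" for y
    proof (rule ccontr)
      assume "\<not> s \<le> y"
      then have "H y < t"
        using s(2)[of y] t SUP_upper[of y "{0..p}" H] by (cases "y \<le> p") auto
      with that show False by simp
    qed
    then have "\<mu> (A \<inter> {x \<in> space M. t \<le> H (f x)}) \<le> \<mu> (A \<inter> {x \<in> space M. s \<le> f x})"
      by (intro monotone_measure_mono[OF assms(1,2)]) auto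
    also have "\<dots> \<le> p"
      using Sugeno_level_le s(1) unfolding assms(9) .
    finally show "\<mu> (A \<inter> {x \<in> space M. t \<le> H (f x)}) \<le> p" .
  qed

  have I2: "?I = max (circ ?KR (\<mu> A)) (circ ?S p)"
    if "\<forall>x\<in>space M. f x = y0 * indicator A x" "H y0 = ?S" for y0
  proof (rule antisym[OF I1])
    \<comment> \<open>Together with \<open>p \<le> \<mu> A\<close> this puts both terms under
      \<open>circ ?S (\<mu> A)\<close>, which is reached at level \<open>H y0\<close>, as
      \<open>f = y0\<close> on \<open>A\<close>.\<close>
    have "?KR \<le> ?S"
      by (auto intro: upper_right_limit_le_SUP SUP_subset_mono)
    then have "max (circ ?KR (\<mu> A)) (circ ?S p) \<le> circ ?S (\<mu> A)"
      using p_le by (intro max.boundedI mono) auto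
    also have "\<dots> \<le> ?I"
      using that AM by (intro gen_Sugeno_integral_ge[OF assms(1,2)]) auto
    finally show "max (circ ?KR (\<mu> A)) (circ ?S p) \<le> ?I" .
  qed

  have II1: "?I \<le> max (circ ?KL (\<mu> A)) (circ ?S (\<mu> A - p))" if wsa: "weakly_superadditive_on M \<mu> A"
  proof (rule gen_Sugeno_integral_le[where H = H and f = f, OF assms(1,2,3,5,8)])
    fix t assume t: "?KL < t"
    have upper: "H y < t" if "p \<le> y" for y
      using t SUP_upper[of y "{p..}" H] that by auto
    show "\<mu> (A \<inter> {x \<in> space M. t \<le> H (f x)}) \<le> \<mu> A - p"
    \<comment> \<open>At \<open>p = 0\<close> there is no left neighbourhood, but
      \<open>upper\<close> already covers every \<open>y\<close>.\<close>
    proof (cases "p = 0")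
      case True
      then have empty: "{x \<in> space M. t \<le> H (f x)} = {}"
        using upper by (auto simp: not_le)
      show ?thesis
        using assms(1) unfolding empty by (simp add: monotone_measure_def)
    next
      case False
      then obtain s' where s': "s' < p" "\<And>y. s' < y \<Longrightarrow> y < p \<Longrightarrow> H y < t"
        using upper_left_limit_lessD[of H p t] t assms(10) by (auto simp: zero_less_iff_neq_zero)
      \<comment> \<open>\<open>s < p\<close> makes the level set of \<open>f\<close> at
        \<open>s\<close> have measure at least \<open>p\<close>, while \<open>s' < s\<close> keeps
        \<open>H\<close> below \<open>t\<close> at \<open>s\<close> itself.\<close>
      obtain s where s: "s' < s" "s < p"
        using dense[OF s'(1)] by blast
      let ?B = "{x \<in> space M. s \<le> f x}"
      have "\<not> s \<le> f x" if "t \<le> H (f x)" for x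
      proof
        assume "s \<le> f x"
        then have "H (f x) < t"
          using s'(2)[of "f x"] upper[of "f x"] s by (cases "p \<le> f x") auto
        with that show False by simp
      qed
      then have "A \<inter> {x \<in> space M. t \<le> H (f x)} \<subseteq> A \<inter> (space M - ?B)"
        by blast
      then have "\<mu> (A \<inter> {x \<in> space M. t \<le> H (f x)}) \<le> \<mu> (A \<inter> (space M - ?B))"
        by (rule monotone_measure_mono[OF assms(1,2), rotated 2]) measurable
      moreover have "p \<le> \<mu> (A \<inter> ?B)"
        using Sugeno_le_level[OF assms(1,2,7)] s(2) unfolding assms(9) .
      moreover have "\<mu> (A \<inter> ?B) + \<mu> (A \<inter> (space M - ?B)) \<le> \<mu> A"
      proof -
        have "?B \<in> sets M" by measurable
        with wsa show ?thesis by (auto simp: weakly_superadditive_on_def)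
      qed
      ultimately have "p + \<mu> (A \<inter> {x \<in> space M. t \<le> H (f x)}) \<le> \<mu> A"
        by (meson add_mono order_trans)
      \<comment> \<open>Moving \<open>p\<close> to the right-hand side of the inequality uses that
        it is finite.\<close>
      then show ?thesis
        using assms(10) by (simp add: ennreal_le_minus_iff add.commute)
    qed
  qed

  have II2: "?I = max (circ ?KL (\<mu> A)) (circ ?S (\<mu> A - p))"
    if "weakly_superadditive_on M \<mu> A" and f_eq: "\<forall>x\<in>space M. f x = \<mu> A * indicator A x"
      and cont: "continuous (at_left p) H" and H_p: "H p = (SUP y\<in>{p..}. H y)"
  proof (rule antisym[OF II1[OF that(1)]])
    \<comment> \<open>Testing the Sugeno integral at level \<open>\<mu> A\<close> forces
      \<open>p = \<mu> A\<close>. The second term then becomes \<open>circ ?S 0 = 0\<close>, and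
      \<open>?KL\<close> collapses to \<open>H p\<close> by left-continuity.\<close>
    have level: "A \<inter> {x \<in> space M. \<mu> A \<le> f x} = A"
      using f_eq AM by auto
    have "min (\<mu> A) (\<mu> (A \<inter> {x \<in> space M. \<mu> A \<le> f x})) \<le> p"
      unfolding assms(9) Sugeno_integral_def by (rule SUP_upper) simp
    then have "\<mu> A \<le> p"
      unfolding level by simp
    with p_le have p_eq: "p = \<mu> A" by simp
    have "?KL = H p"
      using upper_left_limit_le[OF cont assms(10)] by (simp add: H_p[symmetric] max_absorb2)
    moreover have "\<mu> A - p = 0"
      using p_eq assms(10) by simp
    ultimately have "max (circ ?KL (\<mu> A)) (circ ?S (\<mu> A - p)) = circ (H (\<mu> A)) (\<mu> A)"
      using assms(5) p_eq by (simp add: max_absorb1)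
    also have "\<dots> \<le> ?I"
      using f_eq AM by (intro gen_Sugeno_integral_ge[OF assms(1,2)]) auto
    finally show "max (circ ?KL (\<mu> A)) (circ ?S (\<mu> A - p)) \<le> ?I" .
  qed

  show ?thesis
    by (intro conjI allI impI I1 I2 II1 II2)
qed

end
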